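(* For any triangle-free graph $G$ with at least one edge, $$\beta(G)\leq\frac18\rho(G)-\frac{C_4(G)}{12\rho(G)}.$$
   Context: All graphs are finite and simple. Let $G$ be a graph with $n\geq 1$ vertices. The edge density is $\rho(G)=\frac{2|E(G)|}{n^2}$. The density of quadrilaterals $C_4(G)$ is defined as follows: sample $v_1,v_2,v_3,v_4\in V(G)$ uniformly and completely independently (with repetitions allowed), and form the graph on the vertex set $\{1,2,3,4\}$ in which $\{i,j\}$ is an edge if and only if $\{v_i,v_j\}\in E(G)$ (in particular $\{i,j\}$ is not an edge if $v_i=v_j$); then $C_4(G)$ is the probability that this graph is isomorphic to the 4-cycle $C_4$. A half in $G$ is a function $\mu: V(G)\to[0,1]$ such that $\sum_{v\in V(G)}\mu(v)=n/2$. Put $\beta(G,\mu)=\frac1{n^2}\sum_{\{u,v\}\in E(G)}\mu(u)\mu(v)$ (each edge is counted once) and $\beta(G)=\min\{\beta(G,\mu): \mu \text{ is a half in } G\}$. *)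

theory Defs
  imports "HOL-Probability.Probability" "HOL-Library.Ramsey"
begin

text \<open>
  A graph is given by its vertex set \<open>V\<close> and its edge set \<open>E\<close>, where edges are
  unordered pairs of distinct vertices; \<open>nsets V k\<close> is the set of \<open>k\<close>-element subsets of \<open>V\<close>.
\<close>

definition simple_graph :: "'a set \<Rightarrow> 'a set set \<Rightarrow> bool" where
  "simple_graph V E \<longleftrightarrow> finite V \<and> E \<subseteq> nsets V 2"

definition triangle_free :: "'a set \<Rightarrow> 'a set set \<Rightarrow> bool" where
  "triangle_free V E \<longleftrightarrow> (\<forall>T\<in>nsets V 3. \<not> clique T E)"

definition graph_iso :: "'a set \<Rightarrow> 'a set set \<Rightarrow> 'b set \<Rightarrow> 'b set set \<Rightarrow> bool" where
  "graph_iso V E V' E' \<longleftrightarrow>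
     (\<exists>f. bij_betw f V V' \<and> (\<forall>u\<in>V. \<forall>v\<in>V. {u, v} \<in> E \<longleftrightarrow> {f u, f v} \<in> E'))"

definition edge_density :: "'a set \<Rightarrow> 'a set set \<Rightarrow> real" where
  "edge_density V E = 2 * real (card E) / (real (card V))\<^sup>2"

text \<open>
  The graph on the index set \<open>I\<close> induced by a sample \<open>x\<close> of vertices. Since edges are
  two-element sets, \<open>{i, j}\<close> is not an edge if \<open>x i = x j\<close>.
\<close>

definition sample_edges :: "'a set set \<Rightarrow> 'i set \<Rightarrow> ('i \<Rightarrow> 'a) \<Rightarrow> 'i set set" where
  "sample_edges E I x = {{i, j} | i j. i \<in> I \<and> j \<in> I \<and> {x i, x j} \<in> E}"

text \<open>
  The probability is over four independent uniform vertices; the second argument of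
  \<open>Pi_pmf\<close> is only the value of the sample outside the index set.
\<close>

definition C4_density :: "'a set \<Rightarrow> 'a set set \<Rightarrow> real" where
  "C4_density V E =
     measure_pmf.prob (Pi_pmf {1..4::nat} undefined (\<lambda>_. pmf_of_set V))
       {x. graph_iso {1..4::nat} (sample_edges E {1..4} x)
             {1..4::nat} {{1, 2}, {2, 3}, {3, 4}, {4, 1}}}"

text \<open>A half is constrained on \<open>V\<close> only; its values elsewhere are irrelevant below.\<close>

definition halves :: "'a set \<Rightarrow> ('a \<Rightarrow> real) set" where
  "halves V = {\<mu>. (\<forall>v\<in>V. 0 \<le> \<mu> v \<and> \<mu> v \<le> 1) \<and> (\<Sum>v\<in>V. \<mu> v) = real (card V) / 2}"

definition half_density :: "'a set \<Rightarrow> 'a set set \<Rightarrow> ('a \<Rightarrow> real) \<Rightarrow> real" where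
  "half_density V E \<mu> = (1 / (real (card V))\<^sup>2) * (\<Sum>e\<in>E. \<Prod>v\<in>e. \<mu> v)"

definition min_half_density :: "'a set \<Rightarrow> 'a set set \<Rightarrow> real" where
  "min_half_density V E = (INF \<mu>\<in>halves V. half_density V E \<mu>)"

text \<open>The infimum is a minimum.\<close>

lemma min_half_density_attained:
  fixes V :: "'a set"
  assumes G: "simple_graph V E"
  shows "\<exists>\<mu>\<in>halves V. min_half_density V E = half_density V E \<mu> \<and>
           (\<forall>\<nu>\<in>halves V. half_density V E \<mu> \<le> half_density V E \<nu>)"
proof -
  define B where "B = (UNIV \<rightarrow>\<^sub>E {0..1} :: ('a \<Rightarrow> real) set)"
  define K where "K = B \<inter> {\<mu>. (\<Sum>v\<in>V. \<mu> v) = real (card V) / 2}"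
  have finV: "finite V" and EV: "\<And>e. e \<in> E \<Longrightarrow> e \<subseteq> V"
    using G by (auto simp: simple_graph_def nsets_def)
  have "compactin (product_topology (\<lambda>_::'a. euclidean :: real topology) UNIV) B"
    unfolding B_def compactin_PiE by simp
  then have cB: "compact B"
    by (simp add: euclidean_product_topology)
  have cs: "continuous_on UNIV (\<lambda>\<mu>::'a \<Rightarrow> real. \<Sum>v\<in>V. \<mu> v)"
    by (intro continuous_intros continuous_on_product_coordinates)
  have "closed {\<mu>::'a \<Rightarrow> real. (\<Sum>v\<in>V. \<mu> v) = real (card V) / 2}"
    by (rule closed_Collect_eq[OF cs continuous_on_const])
  then have cK: "compact K"
    unfolding K_def using cB by (rule compact_Int_closed[rotated])
  have "(\<lambda>_. 1/2) \<in> K"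
    by (auto simp: K_def B_def)
  then have neK: "K \<noteq> {}" by blast
  have ch: "continuous_on K (half_density V E)"
    unfolding half_density_def
    by (intro continuous_intros continuous_on_subset[OF continuous_on_product_coordinates]) auto
  obtain \<mu> where \<mu>: "\<mu> \<in> K" "\<And>\<nu>. \<nu> \<in> K \<Longrightarrow> half_density V E \<mu> \<le> half_density V E \<nu>"
    using continuous_attains_inf[OF cK neK ch] by blast
  have \<mu>h: "\<mu> \<in> halves V"
    using \<mu>(1) by (auto simp: K_def B_def halves_def PiE_iff)
  have le: "half_density V E \<mu> \<le> half_density V E \<nu>" if \<nu>: "\<nu> \<in> halves V" for \<nu>
  proof -
    define \<nu>' where "\<nu>' = (\<lambda>v. if v \<in> V then \<nu> v else 0)"
    have "\<nu>' \<in> K"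
      using \<nu> by (auto simp: \<nu>'_def K_def B_def halves_def PiE_iff cong: sum.cong)
    moreover have "half_density V E \<nu>' = half_density V E \<nu>"
      unfolding half_density_def
      by (intro arg_cong2[where f = "(*)"] sum.cong prod.cong refl) (use EV in \<open>auto simp: \<nu>'_def\<close>)
    ultimately show ?thesis using \<mu>(2) by metis
  qed
  have "min_half_density V E = half_density V E \<mu>"
    unfolding min_half_density_def
    by (rule cInf_eq_minimum) (use \<mu>h le in auto)
  then show ?thesis using \<mu>h le by blast
qed

end

theory Submission
  imports Defs
begin

text \<open>
  For an edge \<open>uv\<close> let \<open>P\<close>, \<open>Q\<close> be the neighbourhoods of \<open>u\<close>, \<open>v\<close>; they are disjoint and independent,
  and summing \<open>e(P, Q)\<close> over ordered edges counts the homomorphisms from the 4-cycle. An edge with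
  at least average \<open>e(P, Q)\<close> therefore reduces the theorem to finding a half whose weight falls short of
  that of the constant half \<open>1/2\<close> by at least \<open>e(P, Q) / (4 n\<^sup>2)\<close>. If some degree exceeds \<open>n/2\<close>, a half
  supported on that neighbourhood has weight 0. Otherwise take the value 1 on \<open>P\<close>, 0 on \<open>Q\<close>, or vice
  versa, and the constant on the remaining vertices that balances the total: one of these two halves
  always works.
\<close>

section \<open>Halves built from independent sets\<close>

text \<open>Pairs are ordered: for a symmetric 0/1 adjacency function, \<open>X = Y\<close> counts
  each edge inside \<open>X\<close> twice.\<close>

definition weight_between :: "('a \<Rightarrow> 'a \<Rightarrow> real) \<Rightarrow> 'a set \<Rightarrow> 'a set \<Rightarrow> real" where
  "weight_between a X Y = (\<Sum>x\<in>X. \<Sum>y\<in>Y. a x y)"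

lemma weight_between_nonneg:
  assumes "\<And>x y. 0 \<le> a x y"
  shows "0 \<le> weight_between a X Y"
  unfolding weight_between_def by (intro sum_nonneg assms)

lemma weight_between_commute:
  assumes "\<And>x y. a x y = a y x"
  shows "weight_between a X Y = weight_between a Y X"
  unfolding weight_between_def by (subst sum.swap) (simp add: assms)

text \<open>The double sum splits into nine blocks: symmetry pairs the mixed ones, and independence
  removes \<open>P\<close> with \<open>P\<close> and \<open>Q\<close> with \<open>Q\<close>. It
  serves for both tilted halves and, with all values 1, for the total weight.\<close>

lemma weighted_sum_three_parts:
  fixes a :: "'a \<Rightarrow> 'a \<Rightarrow> real"
  assumes "finite P" "finite Q" "finite R"
    and "P \<inter> Q = {}" "P \<inter> R = {}" "Q \<inter> R = {}"
    and sym: "\<And>x y. a x y = a y x"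
    and indep: "weight_between a P P = 0" "weight_between a Q Q = 0"
    and \<mu>: "\<And>x. x \<in> P \<Longrightarrow> \<mu> x = \<alpha>" "\<And>x. x \<in> Q \<Longrightarrow> \<mu> x = \<beta>" "\<And>x. x \<in> R \<Longrightarrow> \<mu> x = \<gamma>"
  shows "(\<Sum>x\<in>P \<union> Q \<union> R. \<Sum>y\<in>P \<union> Q \<union> R. a x y * \<mu> x * \<mu> y) =
    2 * \<alpha> * \<beta> * weight_between a P Q + 2 * \<alpha> * \<gamma> * weight_between a P R
    + 2 * \<beta> * \<gamma> * weight_between a Q R + \<gamma>\<^sup>2 * weight_between a R R"
proof -
  have const: "(\<Sum>x\<in>X. \<Sum>y\<in>Y. a x y * \<mu> x * \<mu> y) = c * d * weight_between a X Y"
    if "\<And>x. x \<in> X \<Longrightarrow> \<mu> x = c" "\<And>y. y \<in> Y \<Longrightarrow> \<mu> y = d" for X Y c d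
    unfolding weight_between_def sum_distrib_left
    by (intro sum.cong refl) (simp add: that)
  have union: "sum f (P \<union> Q \<union> R) = sum f P + sum f Q + sum f R" for f :: "'a \<Rightarrow> real"
    using assms(1-6) by (subst sum.union_disjoint; auto simp: sum.union_disjoint)+
  have "(\<Sum>x\<in>P \<union> Q \<union> R. \<Sum>y\<in>P \<union> Q \<union> R. a x y * \<mu> x * \<mu> y) =
      \<alpha> * \<alpha> * weight_between a P P + \<alpha> * \<beta> * weight_between a P Q + \<alpha> * \<gamma> * weight_between a P R
    + (\<beta> * \<alpha> * weight_between a Q P + \<beta> * \<beta> * weight_between a Q Q + \<beta> * \<gamma> * weight_between a Q R)
    + (\<gamma> * \<alpha> * weight_between a R P + \<gamma> * \<beta> * weight_between a R Q + \<gamma> * \<gamma> * weight_between a R R)"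
    unfolding union sum.distrib by (simp add: const[OF \<mu>(1) \<mu>(1)] const[OF \<mu>(1) \<mu>(2)] const[OF \<mu>(1) \<mu>(3)]
      const[OF \<mu>(2) \<mu>(1)] const[OF \<mu>(2) \<mu>(2)] const[OF \<mu>(2) \<mu>(3)]
      const[OF \<mu>(3) \<mu>(1)] const[OF \<mu>(3) \<mu>(2)] const[OF \<mu>(3) \<mu>(3)])
  then show ?thesis
    using weight_between_commute[of a Q P] weight_between_commute[of a R P]
      weight_between_commute[of a R Q] sym indep
    by (simp add: algebra_simps power2_eq_square)
qed

text \<open>The left sides are the weights of the two tilted halves; the right side is that of the
  constant half without the pairs between \<open>P\<close> and \<open>Q\<close>. If both bounds
  fail, \<open>p - w\<close> is squeezed: comparing its two bounds gives
  \<open>2 * (p - w) < h * \<tau>\<close>, while the first alone gives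
  \<open>2 * (p - w) > h * \<tau>\<close> because \<open>\<tau> \<le> 1\<close>.\<close>

lemma tilted_quadratics_min_le:
  fixes p w h \<tau> :: real
  assumes "0 \<le> p" "0 \<le> w" "0 \<le> h" "0 \<le> \<tau>" "\<tau> \<le> 1"
  shows "p * (1 - \<tau>) + h * (1 - \<tau>)\<^sup>2 / 4 \<le> (2 * p + 2 * w + h) / 4
    \<or> w * (1 + \<tau>) + h * (1 + \<tau>)\<^sup>2 / 4 \<le> (2 * p + 2 * w + h) / 4"
proof (rule ccontr)
  assume "\<not> ?thesis"
  then have 1: "p - w > 2 * (p * \<tau>) + h * \<tau> - h * \<tau>\<^sup>2 / 2"
    and 2: "p - w < 2 * (w * \<tau>) + h * \<tau> + h * \<tau>\<^sup>2 / 2"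
    by (auto simp: field_simps power2_eq_square)
  \<comment> \<open>The upper bound for \<open>p - w\<close> exceeds the lower one; the strict
    inequality lets the nonnegative factor \<open>\<tau>\<close> be cancelled.\<close>
  have "\<tau> * (2 * (p - w)) < \<tau> * (h * \<tau>)"
    using 1 2 by (simp add: algebra_simps power2_eq_square)
  then have lt: "2 * (p - w) < h * \<tau>"
    using \<open>0 \<le> \<tau>\<close> by (rule mult_left_less_imp_less)
  have "h * \<tau>\<^sup>2 \<le> h * \<tau>"
    using assms by (intro mult_left_mono) (auto simp: power2_eq_square mult_left_le)
  moreover have "0 \<le> p * \<tau>" using assms by simp
  \<comment> \<open>Here \<open>A\<close> is \<open>h * \<tau>\<close>, \<open>B\<close> is
    \<open>h * \<tau>\<^sup>2\<close>, \<open>C\<close> is \<open>p * \<tau>\<close> and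
    \<open>d\<close> is \<open>p - w\<close>.\<close>
  moreover have False if "B \<le> A" "0 \<le> C" "2 * C + A - B / 2 < d" "2 * d < A" for A B C d :: real
    using that by linarith
  ultimately show False using 1 lt by blast
qed

lemma exists_half_two_independent_sets_aux:
  fixes a :: "'a \<Rightarrow> 'a \<Rightarrow> real"
  assumes V: "finite V" and PQ: "P \<subseteq> V" "Q \<subseteq> V" "P \<inter> Q = {}"
    and sym: "\<And>x y. a x y = a y x" and nonneg: "\<And>x y. 0 \<le> a x y"
    and indep: "weight_between a P P = 0" "weight_between a Q Q = 0"
    and card: "2 * card P \<le> card V" "card Q \<le> card P"
  shows "\<exists>\<mu>\<in>halves V. (\<Sum>x\<in>V. \<Sum>y\<in>V. a x y * \<mu> x * \<mu> y)
    \<le> (weight_between a V V - 2 * weight_between a P Q) / 4"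
proof -
  define R where "R = V - (P \<union> Q)"
  \<comment> \<open>With 1 on \<open>P\<close> and 0 on \<open>Q\<close>, the sum over
    \<open>P\<close> and \<open>Q\<close> exceeds half their joint size by
    \<open>(card P - card Q) / 2\<close>, so the value on \<open>R\<close> must drop from 1/2 by
    \<open>\<tau> / 2\<close>; exchanging 0 and 1 raises it by the same amount.\<close>
  define \<tau> where "\<tau> = (real (card P) - real (card Q)) / real (card R)"
  have fin: "finite P" "finite Q" "finite R"
    using V PQ by (auto simp: R_def intro: finite_subset)
  have disj: "P \<inter> Q = {}" "P \<inter> R = {}" "Q \<inter> R = {}" and Veq: "V = P \<union> Q \<union> R"
    using PQ by (auto simp: R_def)
  have cardV: "card V = card P + card Q + card R"
    unfolding Veq using fin disj by (subst card_Un_disjoint; auto simp: card_Un_disjoint)+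
  \<comment> \<open>\<open>2 * card P \<le> card V\<close> amounts to
    \<open>card P - card Q \<le> card R\<close>. If \<open>R\<close> is empty, \<open>P\<close> and
    \<open>Q\<close> have equal size, so the value 0 of the division by zero is still the right
    one.\<close>
  have \<tau>: "0 \<le> \<tau>" "\<tau> \<le> 1" and \<tau>R: "\<tau> * real (card R) = real (card P) - real (card Q)"
    using card cardV by (auto simp: \<tau>_def divide_le_eq)
  define \<mu> where "\<mu> \<alpha> \<beta> \<gamma> x = (if x \<in> P then \<alpha> else if x \<in> Q then \<beta> else \<gamma>)"
    for \<alpha> \<beta> \<gamma> :: real and x
  have \<mu>: "\<mu> \<alpha> \<beta> \<gamma> x = \<alpha>" if "x \<in> P" for \<alpha> \<beta> \<gamma> x using that by (simp add: \<mu>_def)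
  have \<mu>': "\<mu> \<alpha> \<beta> \<gamma> x = \<beta>" if "x \<in> Q" for \<alpha> \<beta> \<gamma> x using that disj by (auto simp: \<mu>_def)
  have \<mu>'': "\<mu> \<alpha> \<beta> \<gamma> x = \<gamma>" if "x \<in> R" for \<alpha> \<beta> \<gamma> x using that disj by (auto simp: \<mu>_def)
  note \<mu>s = \<mu> \<mu>' \<mu>''
  have sum\<mu>: "(\<Sum>x\<in>V. \<mu> \<alpha> \<beta> \<gamma> x) = card P * \<alpha> + card Q * \<beta> + card R * \<gamma>"
    for \<alpha> \<beta> \<gamma> :: real
  proof -
    have "(\<Sum>x\<in>V. \<mu> \<alpha> \<beta> \<gamma> x) = sum (\<mu> \<alpha> \<beta> \<gamma>) P + sum (\<mu> \<alpha> \<beta> \<gamma>) Q + sum (\<mu> \<alpha> \<beta> \<gamma>) R"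
      unfolding Veq using fin disj by (subst sum.union_disjoint; auto simp: sum.union_disjoint)+
    then show ?thesis by (simp add: \<mu>s)
  qed
  define p w h where "p = weight_between a P R" and "w = weight_between a Q R"
    and "h = weight_between a R R"
  note quad = weighted_sum_three_parts[OF fin disj sym indep, folded Veq p_def w_def h_def]
  have total: "weight_between a V V - 2 * weight_between a P Q = 2 * p + 2 * w + h"
    using quad[of "\<lambda>_. 1" 1 1 1] by (simp add: weight_between_def)
  have S1: "(\<Sum>x\<in>V. \<Sum>y\<in>V. a x y * \<mu> 1 0 ((1 - \<tau>) / 2) x * \<mu> 1 0 ((1 - \<tau>) / 2) y)
      = p * (1 - \<tau>) + h * (1 - \<tau>)\<^sup>2 / 4"
    by (subst quad[OF \<mu>s]) (auto simp: power2_eq_square field_simps)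
  have S2: "(\<Sum>x\<in>V. \<Sum>y\<in>V. a x y * \<mu> 0 1 ((1 + \<tau>) / 2) x * \<mu> 0 1 ((1 + \<tau>) / 2) y)
      = w * (1 + \<tau>) + h * (1 + \<tau>)\<^sup>2 / 4"
    by (subst quad[OF \<mu>s]) (auto simp: power2_eq_square field_simps)
  have H1: "\<mu> 1 0 ((1 - \<tau>) / 2) \<in> halves V" and H2: "\<mu> 0 1 ((1 + \<tau>) / 2) \<in> halves V"
    unfolding halves_def mem_Collect_eq sum\<mu> cardV
    using \<tau> \<tau>R by (auto simp: \<mu>_def field_simps)
  have "0 \<le> p" "0 \<le> w" "0 \<le> h"
    unfolding p_def w_def h_def by (intro weight_between_nonneg nonneg)+
  from tilted_quadratics_min_le[OF this \<tau>] show ?thesis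
    unfolding total S1[symmetric] S2[symmetric] using H1 H2 by blast
qed

lemma exists_half_two_independent_sets:
  fixes a :: "'a \<Rightarrow> 'a \<Rightarrow> real"
  assumes "finite V" and "P \<subseteq> V" "Q \<subseteq> V" "P \<inter> Q = {}"
    and sym: "\<And>x y. a x y = a y x" and nonneg: "\<And>x y. 0 \<le> a x y"
    and "weight_between a P P = 0" "weight_between a Q Q = 0"
    and "2 * card P \<le> card V" "2 * card Q \<le> card V"
  shows "\<exists>\<mu>\<in>halves V. (\<Sum>x\<in>V. \<Sum>y\<in>V. a x y * \<mu> x * \<mu> y)
    \<le> (weight_between a V V - 2 * weight_between a P Q) / 4"
proof (cases "card Q \<le> card P")
  case True
  with assms show ?thesis by (intro exists_half_two_independent_sets_aux)
next
  case False
  then show ?thesis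
    using exists_half_two_independent_sets_aux[of V Q P a] assms weight_between_commute[of a Q P]
    by (auto simp: Int_commute)
qed

text \<open>Spreading the total \<open>card V / 2\<close> evenly over \<open>P\<close> keeps each
  value below 1, and all positive values lie on an independent set.\<close>

lemma exists_half_on_large_independent_set:
  fixes a :: "'a \<Rightarrow> 'a \<Rightarrow> real"
  assumes "finite V" "P \<subseteq> V" and zero: "\<And>x y. x \<in> P \<Longrightarrow> y \<in> P \<Longrightarrow> a x y = 0"
    and card: "card V < 2 * card P"
  shows "\<exists>\<mu>\<in>halves V. (\<Sum>x\<in>V. \<Sum>y\<in>V. a x y * \<mu> x * \<mu> y) = 0"
proof
  let ?\<mu> = "\<lambda>x. if x \<in> P then real (card V) / (2 * real (card P)) else 0"
  show "?\<mu> \<in> halves V"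
    using assms by (auto simp: halves_def sum.If_cases Int_absorb1 divide_le_eq)
  show "(\<Sum>x\<in>V. \<Sum>y\<in>V. a x y * ?\<mu> x * ?\<mu> y) = 0"
    by (intro sum.neutral ballI) (auto simp: zero)
qed

section \<open>Ordered edges and triangles\<close>

definition adj :: "'a set set \<Rightarrow> 'a \<Rightarrow> 'a \<Rightarrow> real" where
  "adj E u v = of_bool ({u, v} \<in> E)"

definition neighbours :: "'a set \<Rightarrow> 'a set set \<Rightarrow> 'a \<Rightarrow> 'a set" where
  "neighbours V E u = {v \<in> V. {u, v} \<in> E}"

lemma adj_commute: "adj E u v = adj E v u"
  by (simp add: adj_def insert_commute)

lemma adj_nonneg: "0 \<le> adj E u v"
  by (simp add: adj_def)

text \<open>Each edge arises from two ordered pairs. Taking \<open>f\<close> to be a half links the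
  double sums to \<open>half_density\<close>; taking it constantly 1 counts edges.\<close>

lemma sum_ordered_edges:
  fixes f :: "'a \<Rightarrow> real"
  assumes "simple_graph V E"
  shows "(\<Sum>u\<in>V. \<Sum>v\<in>V. adj E u v * f u * f v) = 2 * (\<Sum>e\<in>E. \<Prod>v\<in>e. f v)"
proof -
  have fin: "finite V" and E: "E \<subseteq> nsets V 2" using assms by (auto simp: simple_graph_def)
  have finE: "finite E" using finite_subset[OF E] fin by (simp add: finite_imp_finite_nsets)
  let ?S = "{z \<in> V \<times> V. {fst z, snd z} \<in> E}"
  have "(\<Sum>u\<in>V. \<Sum>v\<in>V. adj E u v * f u * f v) = (\<Sum>z\<in>V \<times> V. adj E (fst z) (snd z) * f (fst z) * f (snd z))"
    by (simp add: sum.cartesian_product case_prod_unfold)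
  also have "\<dots> = (\<Sum>z\<in>?S. f (fst z) * f (snd z))"
    using fin by (intro sum.mono_neutral_cong_right) (auto simp: adj_def)
  \<comment> \<open>Group the ordered pairs by their underlying edge; each fibre consists of a pair
    and its reversal.\<close>
  also have "\<dots> = (\<Sum>e\<in>E. \<Sum>z\<in>{z \<in> ?S. {fst z, snd z} = e}. f (fst z) * f (snd z))"
    by (rule sum.group[symmetric]) (use fin finE in auto)
  also have "\<dots> = (\<Sum>e\<in>E. 2 * (\<Prod>v\<in>e. f v))"
  proof (intro sum.cong refl)
    fix e assume e: "e \<in> E"
    then have "e \<in> nsets V 2" using E by blast
    then obtain x y where xy: "e = {x, y}" "x \<noteq> y" "x \<in> V" "y \<in> V"
      by (auto simp: nsets_def card_2_iff)
    have eq: "{fst z, snd z} = e \<longleftrightarrow> z = (x, y) \<or> z = (y, x)" for z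
      by (cases z) (simp add: xy(1) doubleton_eq_iff)
    have mem: "z \<in> ?S" if "{fst z, snd z} = e" for z
    proof -
      have "fst z \<in> e" "snd z \<in> e" using that by auto
      then have "z \<in> V \<times> V" using xy by (auto simp: mem_Times_iff)
      then show ?thesis using e that by simp
    qed
    have "z \<in> {z \<in> ?S. {fst z, snd z} = e} \<longleftrightarrow> z \<in> {(x, y), (y, x)}" for z
      using eq[of z] mem[of z] by (simp only: mem_Collect_eq insert_iff empty_iff) argo
    then have "{z \<in> ?S. {fst z, snd z} = e} = {(x, y), (y, x)}" by (rule set_eqI)
    then show "(\<Sum>z\<in>{z \<in> ?S. {fst z, snd z} = e}. f (fst z) * f (snd z)) = 2 * (\<Prod>v\<in>e. f v)"
      using xy by simp
  qed
  finally show ?thesis by (simp add: sum_distrib_left)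
qed

lemma triangle_freeD:
  assumes "simple_graph V E" "triangle_free V E" "{x, y} \<in> E" "{y, z} \<in> E" "{x, z} \<in> E"
  shows False
proof -
  have "{x, y} \<in> nsets V 2" "{y, z} \<in> nsets V 2" "{x, z} \<in> nsets V 2"
    using assms(1,3-5) unfolding simple_graph_def by blast+
  then have ne: "x \<noteq> y" "y \<noteq> z" "x \<noteq> z" and V: "x \<in> V" "y \<in> V" "z \<in> V"
    by (simp_all add: doubleton_in_nsets_2)
  then have "{x, y, z} \<in> nsets V 3" by (auto simp: nsets_def)
  moreover have "clique {x, y, z} E"
    using assms(3-5) by (auto simp: clique_def insert_commute)
  ultimately show False using assms(2) by (auto simp: triangle_free_def)
qed

section \<open>Homomorphisms from the 4-cycle and the density of quadrilaterals\<close>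

text \<open>These are the closed walks of length 4: opposite vertices may coincide, and chords are
  ignored.\<close>

definition C4_homs :: "'a set \<Rightarrow> 'a set set \<Rightarrow> ('a \<times> 'a \<times> 'a \<times> 'a) set" where
  "C4_homs V E = {(u, v, z, w). u \<in> V \<and> v \<in> V \<and> z \<in> V \<and> w \<in> V \<and>
     {u, v} \<in> E \<and> {v, z} \<in> E \<and> {z, w} \<in> E \<and> {w, u} \<in> E}"

text \<open>Once the ordered edge \<open>(u, v)\<close> is fixed, the walk is completed by an
  adjacent pair \<open>w\<close>, \<open>z\<close> with \<open>w\<close> a neighbour of
  \<open>u\<close> and \<open>z\<close> one of \<open>v\<close>.\<close>

lemma card_C4_homs:
  assumes "finite V"
  shows "real (card (C4_homs V E)) =
    (\<Sum>u\<in>V. \<Sum>v\<in>V. adj E u v * weight_between (adj E) (neighbours V E u) (neighbours V E v))"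
proof -
  have "weight_between (adj E) (neighbours V E u) (neighbours V E v) =
      (\<Sum>w\<in>V. \<Sum>z\<in>V. of_bool ({u, w} \<in> E \<and> {v, z} \<in> E \<and> {w, z} \<in> E))" for u v
    unfolding weight_between_def neighbours_def adj_def sum.inter_filter[OF assms]
  proof (rule sum.cong[OF refl])
    fix w
    show "(if {u, w} \<in> E then \<Sum>z\<in>V. if {v, z} \<in> E then of_bool ({w, z} \<in> E) else 0 else 0)
      = (\<Sum>z\<in>V. of_bool ({u, w} \<in> E \<and> {v, z} \<in> E \<and> {w, z} \<in> E))"
      by (cases "{u, w} \<in> E") (simp_all only: if_True if_False simp_thms of_bool_conj sum.neutral_const of_bool_eq mult_1 mult_zero_left of_bool_def if_distrib if_bool_eq_conj, auto intro: sum.cong)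
  qed
  then have "(\<Sum>u\<in>V. \<Sum>v\<in>V. adj E u v * weight_between (adj E) (neighbours V E u) (neighbours V E v))
      = (\<Sum>u\<in>V. \<Sum>v\<in>V. \<Sum>w\<in>V. \<Sum>z\<in>V.
          of_bool ({u, v} \<in> E \<and> {u, w} \<in> E \<and> {v, z} \<in> E \<and> {w, z} \<in> E))"
    by (simp add: sum_distrib_left adj_def of_bool_conj)
  also have "\<dots> = (\<Sum>u\<in>V. \<Sum>v\<in>V. \<Sum>z\<in>V. \<Sum>w\<in>V. of_bool ((u, v, z, w) \<in> C4_homs V E))"
  proof (rule sum.cong[OF refl], rule sum.cong[OF refl])
    fix u v assume uv: "u \<in> V" "v \<in> V"
    show "(\<Sum>w\<in>V. \<Sum>z\<in>V. of_bool ({u, v} \<in> E \<and> {u, w} \<in> E \<and> {v, z} \<in> E \<and> {w, z} \<in> E) :: real) =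
      (\<Sum>z\<in>V. \<Sum>w\<in>V. of_bool ((u, v, z, w) \<in> C4_homs V E))"
      by (subst sum.swap, intro sum.cong refl arg_cong[where f = of_bool])
        (use uv in \<open>auto simp: C4_homs_def insert_commute\<close>)
  qed
  also have "\<dots> = (\<Sum>q\<in>V \<times> V \<times> V \<times> V. of_bool (q \<in> C4_homs V E))"
    by (simp add: sum.cartesian_product case_prod_unfold)
  also have "\<dots> = real (card ((V \<times> V \<times> V \<times> V) \<inter> C4_homs V E))"
    using assms by (simp add: sum.If_cases of_bool_def)
  also have "(V \<times> V \<times> V \<times> V) \<inter> C4_homs V E = C4_homs V E"
    by (auto simp: C4_homs_def)
  finally show ?thesis by simp
qed

lemma sample_edges_iff:
  "i \<in> I \<Longrightarrow> j \<in> I \<Longrightarrow> {i, j} \<in> sample_edges E I x \<longleftrightarrow> {x i, x j} \<in> E"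
  by (auto simp: sample_edges_def doubleton_eq_iff insert_commute)

lemma atLeastAtMost_1_4: "{1..4::nat} = {1, 2, 3, 4}"
  by auto

text \<open>The three cases are the three labelled 4-cycles on four points.\<close>

lemma graph_iso_C4_cases:
  assumes "graph_iso {1..4::nat} (sample_edges E {1..4} x) {1..4::nat} {{1, 2}, {2, 3}, {3, 4}, {4, 1}}"
    and "\<And>i. i \<in> {1..4} \<Longrightarrow> x i \<in> V"
  shows "(x 1, x 2, x 3, x 4) \<in> C4_homs V E \<or> (x 1, x 3, x 2, x 4) \<in> C4_homs V E
    \<or> (x 1, x 2, x 4, x 3) \<in> C4_homs V E"
proof -
  obtain f where f: "bij_betw f {1..4::nat} {1..4::nat}"
    and iso: "\<And>u v. u \<in> {1..4} \<Longrightarrow> v \<in> {1..4} \<Longrightarrow>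
      {x u, x v} \<in> E \<longleftrightarrow> {f u, f v} \<in> {{1, 2}, {2, 3}, {3, 4}, {4, 1}}"
    using assms(1) unfolding graph_iso_def by (metis sample_edges_iff)
  have range: "f u \<in> {1, 2, 3, 4}" if "u \<in> {1..4}" for u
    using bij_betwE[OF f] that by (simp only: atLeastAtMost_1_4)
  \<comment> \<open>The 4-cycle is the complete bipartite graph between odd and even labels, so
    adjacency is a difference of parity.\<close>
  have *: "{b, c} \<in> {{1, 2}, {2, 3}, {3, 4}, {4, 1}} \<longleftrightarrow> even b \<noteq> even c"
    if "b \<in> {1, 2, 3, 4}" "c \<in> {1, 2, 3, 4}" for b c :: nat
    using that by (elim insertE emptyE) (simp_all add: doubleton_eq_iff)
  have edge: "{x u, x v} \<in> E \<longleftrightarrow> even (f u) \<noteq> even (f v)" if "u \<in> {1..4}" "v \<in> {1..4}" for u v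
    by (rule trans[OF iso[OF that] *[OF that[THEN range]]])
  have **: "\<not> (even b = even c \<and> even c = even d)"
    if "b \<in> {1, 2, 3, 4}" "c \<in> {1, 2, 3, 4}" "d \<in> {1, 2, 3, 4}" "b \<noteq> c" "b \<noteq> d" "c \<noteq> d" for b c d :: nat
    using that by (elim insertE emptyE) simp_all
  have parity: "\<not> (even (f u) = even (f v) \<and> even (f v) = even (f w))"
    if "u \<in> {1..4}" "v \<in> {1..4}" "w \<in> {1..4}" "u \<noteq> v" "u \<noteq> w" "v \<noteq> w" for u v w
    by (rule **[OF that(1-3)[THEN range]])
      (use that bij_betw_imp_inj_on[OF f] in \<open>simp_all only: inj_on_eq_iff not_False_eq_True\<close>)
  have "x 1 \<in> V" "x 2 \<in> V" "x 3 \<in> V" "x 4 \<in> V" using assms(2) by auto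
  \<comment> \<open>No three images share a parity, so the indices split two against two; the three
    disjuncts correspond to index 1 being paired with 3, 2 or 4.\<close>
  then show ?thesis
    using parity[of 1 2 3] parity[of 1 2 4] parity[of 1 3 4] parity[of 2 3 4]
    by (simp add: C4_homs_def edge) argo
qed

text \<open>The factor 3 counts the cyclic arrangements of four indices. For each one, a sample is
  determined by the closed walk it produces. Since chords are ignored, this is an upper
  bound.\<close>

lemma C4_density_le:
  fixes V :: "'a set"
  assumes V: "finite V" "V \<noteq> {}"
  shows "C4_density V E \<le> 3 * real (card (C4_homs V E)) / real (card V) ^ 4"
proof -
  let ?I = "{1..4::nat}"
  let ?X = "PiE_dflt ?I undefined (\<lambda>_. V)"
  let ?S = "{x. graph_iso ?I (sample_edges E ?I x) ?I {{1, 2}, {2, 3}, {3, 4}, {4, 1}}}"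
  let ?C = "C4_homs V E"
  define hit where "hit g = {x \<in> ?X. (g x :: 'a \<times> 'a \<times> 'a \<times> 'a) \<in> ?C}" for g
  let ?g1 = "\<lambda>x::nat \<Rightarrow> 'a. (x 1, x 2, x 3, x 4)"
  let ?g2 = "\<lambda>x::nat \<Rightarrow> 'a. (x 1, x 3, x 2, x 4)"
  let ?g3 = "\<lambda>x::nat \<Rightarrow> 'a. (x 1, x 2, x 4, x 3)"
  have finX: "finite ?X" using V by (intro finite_PiE_dflt) auto
  have cardX: "card ?X = card V ^ 4" using V by (subst card_PiE_dflt) auto
  have neX: "?X \<noteq> {}" using cardX V by auto
  have finC: "finite ?C"
    by (rule finite_subset[of _ "V \<times> V \<times> V \<times> V"]) (use V in \<open>auto simp: C4_homs_def\<close>)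
  \<comment> \<open>Samples have the fixed value \<open>undefined\<close> off the index set, so four
    coordinates determine them.\<close>
  have ext: "x = y" if "x \<in> ?X" "y \<in> ?X" "x 1 = y 1" "x 2 = y 2" "x 3 = y 3" "x 4 = y 4" for x y
  proof
    fix i
    show "x i = y i"
    proof (cases "i \<in> ?I")
      case True
      then have "i \<in> {1, 2, 3, 4}" by (simp only: atLeastAtMost_1_4)
      then show ?thesis using that by auto
    qed (use that in \<open>auto simp: PiE_dflt_def\<close>)
  qed
  have card_hit: "card (hit g) \<le> card ?C" if "inj_on g ?X" for g
    using finC that by (intro card_inj_on_le[of g]) (auto simp: hit_def inj_on_def)
  have "?X \<inter> ?S \<subseteq> hit ?g1 \<union> hit ?g2 \<union> hit ?g3"
  proof
    fix x assume x: "x \<in> ?X \<inter> ?S"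
    then have "x i \<in> V" if "i \<in> ?I" for i using that by (auto simp: PiE_dflt_def)
    with graph_iso_C4_cases[of E x V] x show "x \<in> hit ?g1 \<union> hit ?g2 \<union> hit ?g3"
      by (auto simp: hit_def)
  qed
  then have "card (?X \<inter> ?S) \<le> card (hit ?g1 \<union> hit ?g2 \<union> hit ?g3)"
    using finX by (intro card_mono) (auto simp: hit_def)
  also have "\<dots> \<le> card (hit ?g1) + card (hit ?g2) + card (hit ?g3)"
    by (meson add_le_mono1 card_Un_le le_trans)
  also have "\<dots> \<le> card ?C + card ?C + card ?C"
    by (intro add_mono card_hit inj_onI; rule ext; simp)
  finally have "card (?X \<inter> ?S) \<le> 3 * card ?C" by simp
  moreover have "C4_density V E = real (card (?X \<inter> ?S)) / real (card V) ^ 4"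
    unfolding C4_density_def
    using V by (subst Pi_pmf_of_set) (simp_all only: measure_pmf_of_set[OF neX finX] cardX finite_atLeastAtMost of_nat_power not_False_eq_True)
  ultimately show ?thesis
    by (auto intro!: divide_right_mono simp flip: of_nat_mult)
qed

section \<open>Choice of the edge and of the half\<close>

theorem proposition1p1:
  fixes V :: "'a set" and E :: "'a set set"
  assumes "simple_graph V E"
    and "triangle_free V E"
    and "E \<noteq> {}"
  shows "min_half_density V E
           \<le> 1 / 8 * edge_density V E - C4_density V E / (12 * edge_density V E)"
proof -
  have V: "finite V" and E: "E \<subseteq> nsets V 2" using assms(1) by (auto simp: simple_graph_def)
  have finE: "finite E" using finite_subset[OF E] V by (simp add: finite_imp_finite_nsets)
  have neV: "V \<noteq> {}" using E assms(3) by (auto simp: nsets_def)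
  define N where "N = neighbours V E"
  define e where "e u v = weight_between (adj E) (N u) (N v)" for u v
  define D where "D = {z \<in> V \<times> V. {fst z, snd z} \<in> E}"
  define n where "n = real (card V)"
  define A where "A = weight_between (adj E) V V"
  have n: "n > 0" using V neV by (simp add: n_def card_gt_0_iff)
  have A: "A = 2 * real (card E)"
    using sum_ordered_edges[OF assms(1), of "\<lambda>_. 1"] by (simp add: A_def weight_between_def)
  have Apos: "A > 0" using A finE assms(3) by (simp add: card_gt_0_iff)
  have N_sub: "N u \<subseteq> V" for u by (auto simp: N_def neighbours_def)
  \<comment> \<open>Triangle-freeness makes each neighbourhood independent and, in
    \<open>N_disj\<close>, the neighbourhoods of adjacent vertices disjoint.\<close>
  have N_indep: "adj E x y = 0" if "x \<in> N u" "y \<in> N u" for u x y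
    using that triangle_freeD[OF assms(1,2), of u x y] by (auto simp: N_def neighbours_def adj_def)
  have N_disj: "N u \<inter> N v = {}" if "{u, v} \<in> E" for u v
    using that triangle_freeD[OF assms(1,2), of u v] by (auto simp: N_def neighbours_def)
  have finD: "finite D" using V by (simp add: D_def)
  have sumD: "(\<Sum>u\<in>V. \<Sum>v\<in>V. adj E u v * g u v) = (\<Sum>z\<in>D. g (fst z) (snd z))" for g
  proof -
    have "(\<Sum>u\<in>V. \<Sum>v\<in>V. adj E u v * g u v) = (\<Sum>z\<in>V \<times> V. adj E (fst z) (snd z) * g (fst z) (snd z))"
      by (simp add: sum.cartesian_product case_prod_unfold)
    also have "\<dots> = (\<Sum>z\<in>D. g (fst z) (snd z))"
      unfolding D_def using V by (intro sum.mono_neutral_cong_right) (auto simp: adj_def)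
    finally show ?thesis .
  qed
  have cardD: "A = real (card D)"
    using sumD[of "\<lambda>_ _. 1"] by (simp add: A_def weight_between_def)
  have neD: "D \<noteq> {}" using cardD Apos by auto
  \<comment> \<open>The homomorphism count is the sum of \<open>e\<close> over the \<open>A\<close>
    ordered edges in \<open>D\<close>, so an edge maximising \<open>e\<close> has at least the
    average.\<close>
  obtain u v where uv: "{u, v} \<in> E" "real (card (C4_homs V E)) \<le> A * e u v"
  proof -
    have "Max ((\<lambda>z. e (fst z) (snd z)) ` D) \<in> (\<lambda>z. e (fst z) (snd z)) ` D"
      using finD neD by (intro Max_in) auto
    then obtain z where z: "z \<in> D" "e (fst z) (snd z) = Max ((\<lambda>z. e (fst z) (snd z)) ` D)" by auto
    have "real (card (C4_homs V E)) = (\<Sum>z\<in>D. e (fst z) (snd z))"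
      unfolding card_C4_homs[OF V] sumD e_def N_def ..
    also have "\<dots> \<le> (\<Sum>z'\<in>D. e (fst z) (snd z))"
      using finD z(2) by (intro sum_mono) auto
    also have "\<dots> = A * e (fst z) (snd z)" by (simp add: cardD)
    finally show ?thesis using z(1) that by (auto simp: D_def)
  qed
  have indepW: "weight_between (adj E) (N x) (N x) = 0" for x
    by (simp add: weight_between_def N_indep)
  obtain \<mu> where \<mu>: "\<mu> \<in> halves V"
    "(\<Sum>x\<in>V. \<Sum>y\<in>V. adj E x y * \<mu> x * \<mu> y) \<le> (A - 2 * e u v) / 4"
  proof (cases "\<exists>x. card V < 2 * card (N x)")
    case True
    then obtain x where x: "card V < 2 * card (N x)" ..
    \<comment> \<open>The half supported on \<open>N x\<close> has weight 0, so it suffices that the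
      target is nonnegative. The pairs from \<open>N u\<close> to \<open>N v\<close> and their
      reversals start in disjoint sets, hence are distinct ordered edges.\<close>
    have "2 * e u v \<le> A"
    proof -
      have "2 * e u v = e u v + weight_between (adj E) (N v) (N u)"
        unfolding e_def using weight_between_commute[of "adj E", OF adj_commute] by simp
      also have "\<dots> \<le> (\<Sum>x\<in>N u. \<Sum>y\<in>V. adj E x y) + (\<Sum>x\<in>N v. \<Sum>y\<in>V. adj E x y)"
        unfolding e_def weight_between_def
        using V N_sub by (intro add_mono sum_mono sum_mono2) (auto simp: adj_nonneg)
      also have "\<dots> = (\<Sum>x\<in>N u \<union> N v. \<Sum>y\<in>V. adj E x y)"
        using N_disj[OF uv(1)] V N_sub by (subst sum.union_disjoint) (auto intro: finite_subset)
      also have "\<dots> \<le> A"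
        unfolding A_def weight_between_def
        using V N_sub by (intro sum_mono2) (auto simp: adj_nonneg intro!: sum_nonneg)
      finally show ?thesis .
    qed
    with exists_half_on_large_independent_set[OF V N_sub N_indep x] that show ?thesis by force
  next
    case False
    then have "2 * card (N x) \<le> card V" for x by (meson not_le)
    with exists_half_two_independent_sets[OF V N_sub N_sub N_disj[OF uv(1)] adj_commute adj_nonneg
        indepW indepW] that show ?thesis
      unfolding A_def e_def by blast
  qed
  have "min_half_density V E \<le> half_density V E \<mu>"
    using min_half_density_attained[OF assms(1)] \<mu>(1) by auto
  \<comment> \<open>The 8 combines the 4 from the value 1/2 on both ends with the 2 from ordered
    pairs.\<close>
  also have "\<dots> \<le> (A - 2 * e u v) / (8 * n\<^sup>2)"
    using \<mu>(2) n unfolding sum_ordered_edges[OF assms(1)] half_density_def n_def[symmetric]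
    by (simp add: field_simps)
  \<comment> \<open>Both sides are equal: the 3 and the 12 leave
    \<open>e u v / (4 * n\<^sup>2)\<close>.\<close>
  also have "\<dots> \<le> 1 / 8 * (A / n\<^sup>2) - (3 * (A * e u v) / n ^ 4) / (12 * (A / n\<^sup>2))"
    using n Apos by (simp add: field_simps power2_eq_square power4_eq_xxxx)
  also have "\<dots> \<le> 1 / 8 * (A / n\<^sup>2) - C4_density V E / (12 * (A / n\<^sup>2))"
  proof -
    have "C4_density V E \<le> 3 * real (card (C4_homs V E)) / n ^ 4"
      using C4_density_le[OF V neV] by (simp add: n_def)
    also have "\<dots> \<le> 3 * (A * e u v) / n ^ 4"
      using uv(2) n by (intro divide_right_mono) auto
    finally show ?thesis
      using n Apos by (intro diff_left_mono divide_right_mono) auto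
  qed
  finally show ?thesis
    by (simp add: edge_density_def A n_def)
qed

end
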